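(* Let $G$ be a finite graph and $n$ a positive integer. Let $Z_G(\alpha,n)=\sum_{S}(\alpha-1)^{e(S)}n^{c(S)}$ (sum over all spanning subgraphs $S$ of $G$). Then $$Z_{G}(\alpha, n) = \sum_{\sigma} \prod_{\langle i,j \rangle} \alpha^{\delta(\sigma(i), \sigma(j))},$$ where $\sigma: \mathrm{Nodes}(G) \to \{1,2,\dots,n\}$ runs over all color assignments to the nodes of $G$, and the product is over all edges $\langle i,j\rangle$ of $G$, with end nodes $i$ and $j$. Thus $$\sum_{i=0}^{\infty} \alpha^{i} C^{i}_{G}(n) = \sum_{\sigma} \prod_{\langle i,j \rangle} \alpha^{\delta(\sigma(i), \sigma(j))},$$ where $C^i_G(n)$ is the number of colorings of the nodes of $G$ with $n$ colors for which exactly $i$ edges have both ends of the same color.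
   Context: $G$ is a finite graph (multiple edges and loops allowed). A spanning subgraph $S$ consists of all nodes of $G$ and a subset of its edges; $e(S)$ is its number of edges and $c(S)$ its number of connected components. $Z_G(\alpha,n)$ is the dichromatic polynomial in the variable $\alpha$; it satisfies $Z_{G}(\alpha,n)=Z_{G-e}(\alpha,n)+(\alpha-1)Z_{G/e}(\alpha,n)$ for deletion $G-e$ and contraction $G/e$ of an edge, and $Z_{G\sqcup\bullet}(\alpha,n)=nZ_G(\alpha,n)$ for adding an isolated node. $\delta(a,b)$ is the Kronecker delta: $0$ when $a\neq b$ and $1$ when $a=b$. A loop has its two ends equal. $\alpha$ is an indeterminate. *)

theory Defs
  imports
    "HOL-Library.FuncSet"
    "HOL-Library.Uprod"
    "HOL-Library.Groups_Big_Fun"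
    "HOL-Computational_Algebra.Polynomial"
begin

text \<open>
  Undirected graphs with multiple edges and loops: edges are names, and each edge name is mapped
  to the unordered pair of its end nodes. A loop at \<open>v\<close> has ends \<open>Upair v v\<close>.
\<close>

record ('v, 'e) multigraph =
  nodes :: "'v set"
  edges :: "'e set"
  ends :: "'e \<Rightarrow> 'v uprod"

definition finite_multigraph :: "('v, 'e) multigraph \<Rightarrow> bool" where
  "finite_multigraph G \<longleftrightarrow>
     finite (nodes G) \<and> finite (edges G) \<and> (\<forall>e \<in> edges G. set_uprod (ends G e) \<subseteq> nodes G)"

definition spanning_subgraphs :: "('v, 'e) multigraph \<Rightarrow> ('v, 'e) multigraph set" where
  "spanning_subgraphs G = {G\<lparr>edges := F\<rparr> | F. F \<subseteq> edges G}"

definition adjacency :: "('v, 'e) multigraph \<Rightarrow> ('v \<times> 'v) set" where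
  "adjacency G = {(u, v). \<exists>e \<in> edges G. ends G e = Upair u v}"

definition connected_components :: "('v, 'e) multigraph \<Rightarrow> 'v set set" where
  "connected_components G = nodes G // (adjacency G)\<^sup>*"

definition num_edges :: "('v, 'e) multigraph \<Rightarrow> nat" where
  "num_edges G = card (edges G)"

definition num_components :: "('v, 'e) multigraph \<Rightarrow> nat" where
  "num_components G = card (connected_components G)"

definition dichromatic :: "('v, 'e) multigraph \<Rightarrow> 'a::comm_ring_1 \<Rightarrow> 'a \<Rightarrow> 'a" where
  "dichromatic G \<alpha> n =
     (\<Sum>S \<in> spanning_subgraphs G. (\<alpha> - 1) ^ num_edges S * n ^ num_components S)"

text \<open>
  Colorings are taken extensional (\<open>undefined\<close> off the nodes), so that each map from the nodes to
  \<open>{1..n}\<close> is represented by exactly one function.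
\<close>

definition colorings :: "('v, 'e) multigraph \<Rightarrow> nat \<Rightarrow> ('v \<Rightarrow> nat) set" where
  "colorings G n = nodes G \<rightarrow>\<^sub>E {1..n}"

definition kronecker_delta :: "'a \<Rightarrow> 'a \<Rightarrow> nat" where
  "kronecker_delta a b = (if a = b then 1 else 0)"

lift_definition ends_delta :: "('v \<Rightarrow> 'c) \<Rightarrow> 'v uprod \<Rightarrow> nat"
  is "\<lambda>\<sigma> (i, j). kronecker_delta (\<sigma> i) (\<sigma> j)"
  by (auto simp: kronecker_delta_def)

lemma ends_delta_Upair [simp]: "ends_delta \<sigma> (Upair i j) = kronecker_delta (\<sigma> i) (\<sigma> j)"
  by transfer simp

definition monochromatic_edges :: "('v, 'e) multigraph \<Rightarrow> ('v \<Rightarrow> 'c) \<Rightarrow> 'e set" where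
  "monochromatic_edges G \<sigma> = {e \<in> edges G. \<forall>i j. ends G e = Upair i j \<longrightarrow> \<sigma> i = \<sigma> j}"

definition num_colorings_mono :: "('v, 'e) multigraph \<Rightarrow> nat \<Rightarrow> nat \<Rightarrow> nat" where
  "num_colorings_mono G n i = card {\<sigma> \<in> colorings G n. card (monochromatic_edges G \<sigma>) = i}"

abbreviation indeterminate :: "int poly" where
  "indeterminate \<equiv> monom 1 1"

text \<open>
  The series over all \<open>i\<close> of \<open>\<alpha> ^ i * C i\<close> has only finitely many nonzero terms, by the
  following fact, so that \<^const>\<open>Sum_any\<close> (which is 0 on infinite support) is its actual sum.
\<close>

lemma finite_support_num_colorings_mono:
  assumes "finite_multigraph G"
  shows "finite {i. indeterminate ^ i * of_nat (num_colorings_mono G n i) \<noteq> 0}"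
proof (rule finite_subset)
  show "{i. indeterminate ^ i * of_nat (num_colorings_mono G n i) \<noteq> 0} \<subseteq> {..card (edges G)}"
  proof
    fix i
    assume "i \<in> {i. indeterminate ^ i * of_nat (num_colorings_mono G n i) \<noteq> 0}"
    then have "num_colorings_mono G n i \<noteq> 0"
      by auto
    then have "{\<sigma> \<in> colorings G n. card (monochromatic_edges G \<sigma>) = i} \<noteq> {}"
      unfolding num_colorings_mono_def by (rule contrapos_nn) (simp only: card.empty)
    then obtain \<sigma> where "\<sigma> \<in> colorings G n" "card (monochromatic_edges G \<sigma>) = i"
      by blast
    moreover have "monochromatic_edges G \<sigma> \<subseteq> edges G"
      unfolding monochromatic_edges_def by (rule Collect_restrict)
    ultimately show "i \<in> {..card (edges G)}"
      using assms card_mono unfolding finite_multigraph_def by blast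
  qed
qed (rule finite_atMost)

end

theory Submission imports Defs begin

text \<open>
  For a coloring with set \<open>M\<close> of monochromatic edges, the product over the edges is \<open>\<alpha>\<^bsup>|M|\<^esup>\<close>.
  Writing \<open>\<alpha> = (\<alpha> - 1) + 1\<close> expands it into the sum of \<open>(\<alpha> - 1)\<^bsup>|F|\<^esup>\<close> over all \<open>F \<subseteq> M\<close>
  (\<open>prod_power_ends_delta_expand\<close>). Exchanging the sums over colorings and over edge sets leaves, for
  each edge set \<open>F\<close>, the number of colorings that are monochromatic on all of \<open>F\<close>. These are the
  colorings that are constant on the components of the spanning subgraph with edge set \<open>F\<close>, so
  there are \<open>n\<^bsup>c(F)\<^esup>\<close> of them (\<open>card_colorings_mono_superset\<close>), which gives the dichromatic
  polynomial. The second identity groups the colorings by \<open>|M|\<close>.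
\<close>

section \<open>Connected components\<close>

lemma sym_adjacency: "sym (adjacency G)"
proof (rule symI)
  fix u v assume "(u, v) \<in> adjacency G"
  then obtain e where "e \<in> edges G" "ends G e = Upair u v"
    by (auto simp: adjacency_def)
  moreover have "Upair u v = Upair v u"
    by simp
  ultimately show "(v, u) \<in> adjacency G"
    unfolding adjacency_def by auto
qed

lemma equiv_adjacency_rtrancl: "equiv UNIV ((adjacency G)\<^sup>*)"
  by (intro equivI refl_rtrancl trans_rtrancl sym_rtrancl sym_adjacency) simp

lemma adjacency_class_eq_iff:
  "(adjacency G)\<^sup>* `` {u} = (adjacency G)\<^sup>* `` {v} \<longleftrightarrow> (u, v) \<in> (adjacency G)\<^sup>*"
  by (simp add: eq_equiv_class_iff[OF equiv_adjacency_rtrancl])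

lemma finite_multigraph_edges_update:
  assumes "finite_multigraph G" "F \<subseteq> edges G"
  shows "finite_multigraph (G\<lparr>edges := F\<rparr>)"
  using assms by (auto simp: finite_multigraph_def intro: finite_subset)


section \<open>Monochromatic edges\<close>

lemma in_monochromatic_edges_iff:
  assumes "ends G e = Upair i j"
  shows "e \<in> monochromatic_edges G \<sigma> \<longleftrightarrow> e \<in> edges G \<and> \<sigma> i = \<sigma> j"
  using assms by (auto simp: monochromatic_edges_def)

lemma ends_delta_eq_of_bool:
  assumes "e \<in> edges G"
  shows "ends_delta \<sigma> (ends G e) = of_bool (e \<in> monochromatic_edges G \<sigma>)"
proof -
  obtain i j where "ends G e = Upair i j"
    by (cases "ends G e")
  then show ?thesis
    using assms in_monochromatic_edges_iff[of G e i j \<sigma>] by (simp add: kronecker_delta_def)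
qed

lemma mono_constant_on_component:
  assumes "(u, v) \<in> (adjacency G)\<^sup>*" "edges G \<subseteq> monochromatic_edges G \<sigma>"
  shows "\<sigma> u = \<sigma> v"
  using assms(1)
proof (induction rule: rtrancl_induct)
  case (step v w)
  then obtain e where "e \<in> edges G" "ends G e = Upair v w"
    by (auto simp: adjacency_def)
  then have "\<sigma> v = \<sigma> w"
    using assms(2) in_monochromatic_edges_iff[of G e v w \<sigma>] by blast
  with step.IH show ?case
    by simp
qed simp

text \<open>
  The colorings that are monochromatic on every edge correspond to the maps from the set of
  components to the colors: such a map is composed with the map from a node to its component.
\<close>

lemma card_colorings_mono_all:
  assumes G: "finite_multigraph G"
  shows "card {\<sigma> \<in> colorings G n. edges G \<subseteq> monochromatic_edges G \<sigma>} = n ^ num_components G"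
proof -
  let ?C = "connected_components G"
  define cls where "cls v = (adjacency G)\<^sup>* `` {v}" for v
  define lift where "lift f = restrict (\<lambda>v. f (cls v)) (nodes G)" for f :: "'a set \<Rightarrow> nat"
  have C: "?C = cls ` nodes G"
    by (auto simp: connected_components_def quotient_def cls_def)
  have fin: "finite ?C"
    using G by (simp add: C finite_multigraph_def)
  have cls_eq: "cls u = cls v \<longleftrightarrow> (u, v) \<in> (adjacency G)\<^sup>*" for u v
    by (simp add: cls_def adjacency_class_eq_iff)
  have inj: "inj_on lift (?C \<rightarrow>\<^sub>E {1..n})"
  proof (rule inj_onI)
    fix f g
    assume f: "f \<in> ?C \<rightarrow>\<^sub>E {1..n}" and g: "g \<in> ?C \<rightarrow>\<^sub>E {1..n}" and eq: "lift f = lift g"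
    show "f = g"
    proof (rule PiE_ext[OF f g])
      fix c assume "c \<in> ?C"
      then obtain v where "v \<in> nodes G" "c = cls v"
        by (auto simp: C)
      then show "f c = g c"
        using fun_cong[OF eq, of v] by (simp add: lift_def)
    qed
  qed
  have "lift ` (?C \<rightarrow>\<^sub>E {1..n}) = {\<sigma> \<in> colorings G n. edges G \<subseteq> monochromatic_edges G \<sigma>}"
    (is "_ = ?M")
  proof (intro equalityI subsetI)
    fix \<sigma> assume "\<sigma> \<in> lift ` (?C \<rightarrow>\<^sub>E {1..n})"
    then obtain f where f: "f \<in> ?C \<rightarrow>\<^sub>E {1..n}" and \<sigma>: "\<sigma> = lift f"
      by blast
    have "\<sigma> \<in> colorings G n"
      using f by (auto simp: \<sigma> lift_def colorings_def C)
    moreover have "e \<in> monochromatic_edges G \<sigma>" if e: "e \<in> edges G" for e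
    proof -
      obtain i j where ij: "ends G e = Upair i j"
        by (cases "ends G e")
      have "cls i = cls j"
        unfolding cls_eq using e ij by (auto simp: adjacency_def)
      moreover have "i \<in> nodes G" "j \<in> nodes G"
        using G e ij by (force simp: finite_multigraph_def)+
      ultimately show ?thesis
        using e by (simp add: in_monochromatic_edges_iff[OF ij] \<sigma> lift_def)
    qed
    ultimately show "\<sigma> \<in> ?M"
      by blast
  next
    fix \<sigma> assume "\<sigma> \<in> ?M"
    then have \<sigma>: "\<sigma> \<in> nodes G \<rightarrow>\<^sub>E {1..n}" and mono: "edges G \<subseteq> monochromatic_edges G \<sigma>"
      by (auto simp: colorings_def)
    \<comment> \<open>The color of a component is the color of an arbitrary node in it.\<close>
    define f where "f = restrict (\<lambda>c. \<sigma> (SOME v. v \<in> c)) ?C"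
    have f_cls: "f (cls v) = \<sigma> v" if v: "v \<in> nodes G" for v
    proof -
      have "v \<in> cls v"
        by (simp add: cls_def)
      then have "(SOME w. w \<in> cls v) \<in> cls v"
        by (rule someI)
      then have "\<sigma> v = \<sigma> (SOME w. w \<in> cls v)"
        using mono_constant_on_component[OF _ mono] by (simp add: cls_def)
      then show ?thesis
        using v by (simp add: f_def C)
    qed
    have "f \<in> ?C \<rightarrow>\<^sub>E {1..n}"
    proof (rule PiE_I)
      fix c assume "c \<in> ?C"
      then show "f c \<in> {1..n}"
        using PiE_mem[OF \<sigma>] f_cls unfolding C by fastforce
    qed (simp add: f_def)
    moreover have "\<sigma> = lift f"
    proof
      fix v show "\<sigma> v = lift f v"
        using f_cls PiE_arb[OF \<sigma>] by (simp add: lift_def)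
    qed
    ultimately show "\<sigma> \<in> lift ` (?C \<rightarrow>\<^sub>E {1..n})"
      by blast
  qed
  then have "card ?M = card (?C \<rightarrow>\<^sub>E {1..n})"
    using card_image[OF inj] by simp
  also have "\<dots> = n ^ num_components G"
    using fin by (simp add: card_PiE num_components_def)
  finally show ?thesis .
qed

lemma card_colorings_mono_superset:
  assumes G: "finite_multigraph G" and F: "F \<subseteq> edges G"
  shows "card {\<sigma> \<in> colorings G n. F \<subseteq> monochromatic_edges G \<sigma>}
           = n ^ num_components (G\<lparr>edges := F\<rparr>)"
proof -
  have "F \<subseteq> monochromatic_edges (G\<lparr>edges := F\<rparr>) \<sigma> \<longleftrightarrow> F \<subseteq> monochromatic_edges G \<sigma>"
    for \<sigma> :: "'a \<Rightarrow> nat"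
    using F by (auto simp: monochromatic_edges_def)
  then show ?thesis
    using card_colorings_mono_all[OF finite_multigraph_edges_update[OF assms], of n]
    by (simp add: colorings_def)
qed


section \<open>The dichromatic polynomial as a sum over colorings\<close>

lemma finite_colorings: "finite_multigraph G \<Longrightarrow> finite (colorings G n)"
  by (simp add: colorings_def finite_multigraph_def finite_PiE)

lemma prod_power_ends_delta:
  fixes \<alpha> :: "'a::comm_ring_1"
  assumes "finite_multigraph G"
  shows "(\<Prod>e\<in>edges G. \<alpha> ^ ends_delta \<sigma> (ends G e)) = \<alpha> ^ card (monochromatic_edges G \<sigma>)"
proof -
  have "(\<Prod>e\<in>edges G. \<alpha> ^ ends_delta \<sigma> (ends G e))
      = \<alpha> ^ (\<Sum>e\<in>edges G. of_bool (e \<in> monochromatic_edges G \<sigma>))"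
    by (simp add: power_sum ends_delta_eq_of_bool)
  also have "(\<Sum>e\<in>edges G. of_bool (e \<in> monochromatic_edges G \<sigma>))
      = card (monochromatic_edges G \<sigma>)"
  proof -
    have "edges G \<inter> monochromatic_edges G \<sigma> = monochromatic_edges G \<sigma>"
      by (auto simp: monochromatic_edges_def)
    then show ?thesis
      using assms by (simp add: finite_multigraph_def)
  qed
  finally show ?thesis .
qed

lemma prod_power_ends_delta_expand:
  fixes \<alpha> :: "'a::comm_ring_1"
  assumes "finite_multigraph G"
  shows "(\<Prod>e\<in>edges G. \<alpha> ^ ends_delta \<sigma> (ends G e))
       = (\<Sum>F | F \<subseteq> edges G \<and> F \<subseteq> monochromatic_edges G \<sigma>. (\<alpha> - 1) ^ card F)"
proof -
  let ?M = "monochromatic_edges G \<sigma>"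
  have M: "?M \<subseteq> edges G" "finite ?M"
    using assms by (auto simp: monochromatic_edges_def finite_multigraph_def)
  have "\<alpha> ^ card ?M = (\<Prod>e\<in>?M. (\<alpha> - 1) + 1)"
    by simp
  also have "\<dots> = (\<Sum>F\<in>Pow ?M. (\<alpha> - 1) ^ card F)"
    by (subst prod_add[OF M(2)]) simp
  also have "Pow ?M = {F. F \<subseteq> edges G \<and> F \<subseteq> ?M}"
    using M(1) by blast
  finally show ?thesis
    by (simp only: prod_power_ends_delta[OF assms])
qed

lemma dichromatic_eq_sum_edge_sets:
  "dichromatic G \<alpha> q =
     (\<Sum>F | F \<subseteq> edges G. (\<alpha> - 1) ^ card F * q ^ num_components (G\<lparr>edges := F\<rparr>))"
proof -
  have "inj_on (\<lambda>F. G\<lparr>edges := F\<rparr>) {F. F \<subseteq> edges G}"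
    by (rule inj_on_inverseI[where g = edges]) simp
  moreover have "spanning_subgraphs G = (\<lambda>F. G\<lparr>edges := F\<rparr>) ` {F. F \<subseteq> edges G}"
    by (auto simp: spanning_subgraphs_def)
  ultimately show ?thesis
    by (simp add: dichromatic_def sum.reindex num_edges_def)
qed

lemma dichromatic_eq_sum_colorings:
  fixes \<alpha> :: "'a::comm_ring_1"
  assumes G: "finite_multigraph G"
  shows "dichromatic G \<alpha> (of_nat n) =
           (\<Sum>\<sigma>\<in>colorings G n. \<Prod>e\<in>edges G. \<alpha> ^ ends_delta \<sigma> (ends G e))"
proof -
  have fin: "finite {F. F \<subseteq> edges G}"
    using G by (simp add: finite_multigraph_def)
  have "dichromatic G \<alpha> (of_nat n) = (\<Sum>F | F \<subseteq> edges G.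
      \<Sum>\<sigma> | \<sigma> \<in> colorings G n \<and> F \<subseteq> monochromatic_edges G \<sigma>. (\<alpha> - 1) ^ card F)"
    unfolding dichromatic_eq_sum_edge_sets
  proof (rule sum.cong[OF refl])
    fix F assume "F \<in> {F. F \<subseteq> edges G}"
    then have "of_nat n ^ num_components (G\<lparr>edges := F\<rparr>)
        = (of_nat (card {\<sigma> \<in> colorings G n. F \<subseteq> monochromatic_edges G \<sigma>}) :: 'a)"
      using card_colorings_mono_superset[OF G] by simp
    then show "(\<alpha> - 1) ^ card F * of_nat n ^ num_components (G\<lparr>edges := F\<rparr>)
        = (\<Sum>\<sigma> | \<sigma> \<in> colorings G n \<and> F \<subseteq> monochromatic_edges G \<sigma>. (\<alpha> - 1) ^ card F)"
      by (simp add: mult.commute)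
  qed
  also have "\<dots> = (\<Sum>\<sigma>\<in>colorings G n.
      \<Sum>F | F \<subseteq> edges G \<and> F \<subseteq> monochromatic_edges G \<sigma>. (\<alpha> - 1) ^ card F)"
    using sum.swap_restrict[OF fin finite_colorings[OF G],
        where R = "\<lambda>F \<sigma>. F \<subseteq> monochromatic_edges G \<sigma>" and g = "\<lambda>F \<sigma>. (\<alpha> - 1) ^ card F"]
    by simp
  finally show ?thesis
    by (simp only: prod_power_ends_delta_expand[OF G])
qed

lemma Sum_any_num_colorings_mono:
  assumes G: "finite_multigraph G"
  shows "Sum_any (\<lambda>i. indeterminate ^ i * of_nat (num_colorings_mono G n i)) =
           (\<Sum>\<sigma>\<in>colorings G n. \<Prod>e\<in>edges G. indeterminate ^ ends_delta \<sigma> (ends G e))"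
proof -
  let ?k = "\<lambda>\<sigma>. card (monochromatic_edges G \<sigma>)"
  let ?I = "?k ` colorings G n"
  have fin: "finite ?I"
    using finite_colorings[OF G] by simp
  have "indeterminate ^ i * of_nat (num_colorings_mono G n i) = 0" if "i \<notin> ?I" for i
  proof -
    have "{\<sigma> \<in> colorings G n. ?k \<sigma> = i} = {}"
      using that by blast
    then show ?thesis
      by (simp only: num_colorings_mono_def card.empty of_nat_0 mult_zero_right)
  qed
  then have "{i. indeterminate ^ i * of_nat (num_colorings_mono G n i) \<noteq> 0} \<subseteq> ?I"
    by blast
  then have "Sum_any (\<lambda>i. indeterminate ^ i * of_nat (num_colorings_mono G n i))
      = (\<Sum>i\<in>?I. indeterminate ^ i * of_nat (num_colorings_mono G n i))"
    by (rule Sum_any.expand_superset[OF fin])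
  also have "\<dots> = (\<Sum>i\<in>?I. \<Sum>\<sigma> | \<sigma> \<in> colorings G n \<and> ?k \<sigma> = i. indeterminate ^ ?k \<sigma>)"
    by (simp add: num_colorings_mono_def mult.commute)
  also have "\<dots> = (\<Sum>\<sigma>\<in>colorings G n. indeterminate ^ ?k \<sigma>)"
    by (rule sum.image_gen[OF finite_colorings[OF G], symmetric])
  finally show ?thesis
    by (simp only: prod_power_ends_delta[OF G])
qed

theorem mainTheorem3:
  fixes G :: "('v, 'e) multigraph" and n :: nat
  assumes "finite_multigraph G" and "n > 0"
  shows "dichromatic G indeterminate (of_nat n) =
           (\<Sum>\<sigma> \<in> colorings G n. \<Prod>e \<in> edges G. indeterminate ^ ends_delta \<sigma> (ends G e))
       \<and> Sum_any (\<lambda>i. indeterminate ^ i * of_nat (num_colorings_mono G n i)) =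
           (\<Sum>\<sigma> \<in> colorings G n. \<Prod>e \<in> edges G. indeterminate ^ ends_delta \<sigma> (ends G e))"
  using dichromatic_eq_sum_colorings[OF assms(1)] Sum_any_num_colorings_mono[OF assms(1)] ..

end
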